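(* Let $1\le p<\infty$. Suppose that a Poincaré $(p,p)$ inequality holds for the class of weights $RH_\infty$ on $\mathbb{R}^n$, namely that for every $w\in RH_\infty$ $$\inf_{a\in\mathbb{R}}\left(\int_Q|f-a|^p\,w\,dx\right)^{1/p}\le c\,\ell(Q)\left(\int_Q|\nabla f|^p\,w\,dx\right)^{1/p}\qquad( * )$$ for all cubes $Q\subset\mathbb{R}^n$ and all Lipschitz functions $f$, with a constant $c$ independent of $Q$ and $f$. Then for every $0<q<1$ it also holds that $$\inf_{a\in\mathbb{R}}\left(\int_Q|f-a|^q\,dx\right)^{1/q}\le c\,\ell(Q)\left(\int_Q|\nabla f|^q\,dx\right)^{1/q}$$ for all cubes $Q$ and all Lipschitz $f$, with a constant $c$ independent of $Q$ and $f$. Since the latter is false, $( * )$ cannot hold for every $w\in RH_\infty$. In particular, $( * )$ cannot hold for every $w\in A_\infty$.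
   Context: Cubes are cubes in $\mathbb{R}^n$ with sides parallel to the coordinate axes, with side length $\ell(Q)$. A weight is a locally integrable non-negative function. A weight $w$ belongs to $RH_\infty$ if there is a constant $c$ such that $\operatorname*{ess\,sup}_Q w\le c\,\frac{1}{|Q|}\int_Q w\,dx$ for every cube $Q$. $A_\infty=\bigcup_{q\ge1}A_q$ is the union of the Muckenhoupt classes, and $RH_\infty\subset A_\infty$. *)

theory Defs
  imports "HOL-Analysis.Analysis" "HOL-Probability.Essential_Supremum"
begin

definition cubes :: "(real ^ 'n) set set" where
  "cubes = {cbox a (\<chi> i. a $ i + l) | a l. l > 0}"

definition side_length :: "(real ^ 'n) set \<Rightarrow> real" where
  "side_length Q = (THE l. l > 0 \<and> (\<exists>a. Q = cbox a (\<chi> i. a $ i + l)))"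

definition weight :: "(real ^ 'n \<Rightarrow> real) \<Rightarrow> bool" where
  "weight w \<longleftrightarrow> (\<forall>x. 0 \<le> w x) \<and> (\<forall>K. compact K \<longrightarrow> set_integrable lebesgue K w)"

definition average :: "(real ^ 'n) set \<Rightarrow> (real ^ 'n \<Rightarrow> real) \<Rightarrow> real" where
  "average Q w = (1 / measure lebesgue Q) * (LINT x:Q|lebesgue. w x)"

definition RH_infinity :: "(real ^ 'n \<Rightarrow> real) set" where
  "RH_infinity = {w. weight w \<and>
     (\<exists>c::real. \<forall>Q\<in>cubes.
        esssup (restrict_space lebesgue Q) (\<lambda>x. ennreal (w x)) \<le> ennreal (c * average Q w))}"

text \<open>The averages in the \<open>A\<^sub>q\<close> condition are taken in \<^typ>\<open>ennreal\<close>, because \<open>w powr (- 1 / (q - 1))\<close>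
  has to be infinite where \<open>w\<close> vanishes (whereas \<open>0 powr r = 0\<close> on the reals) and its average
  may be infinite. The convention \<open>0 * \<infinity> = 0\<close> puts the zero weight into every \<open>A\<^sub>q\<close>, so that
  \<open>RH\<^sub>\<infinity> \<subseteq> A\<^sub>\<infinity>\<close> holds without exception.\<close>

definition nn_average :: "(real ^ 'n) set \<Rightarrow> (real ^ 'n \<Rightarrow> ennreal) \<Rightarrow> ennreal" where
  "nn_average Q g = (\<integral>\<^sup>+x\<in>Q. g x \<partial>lebesgue) / emeasure lebesgue Q"

text \<open>Only used for exponents \<open>r > 0\<close>.\<close>

definition ennreal_powr :: "ennreal \<Rightarrow> real \<Rightarrow> ennreal" where
  "ennreal_powr x r = (if x = \<infinity> then \<infinity> else ennreal (enn2real x powr r))"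

definition Muckenhoupt :: "real \<Rightarrow> (real ^ 'n \<Rightarrow> real) set" where
  "Muckenhoupt q = {w. weight w \<and>
     (if q = 1
      then \<exists>c::real. \<forall>Q\<in>cubes. AE x in lebesgue. x \<in> Q \<longrightarrow> average Q w \<le> c * w x
      else \<exists>c::real. \<forall>Q\<in>cubes.
             nn_average Q (\<lambda>x. ennreal (w x)) *
             ennreal_powr (nn_average Q (\<lambda>x. inverse (ennreal (w x powr (1 / (q - 1)))))) (q - 1)
             \<le> ennreal c)}"

definition A_infinity :: "(real ^ 'n \<Rightarrow> real) set" where
  "A_infinity = (\<Union>q\<in>{1..}. Muckenhoupt q)"

text \<open>A Lipschitz function is differentiable almost everywhere (Rademacher), so the value chosen
  at the remaining points does not affect the integrals below.\<close>

definition gradient :: "(real ^ 'n \<Rightarrow> real) \<Rightarrow> real ^ 'n \<Rightarrow> real ^ 'n" where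
  "gradient f x = (if f differentiable (at x) then (THE D. GDERIV f x :> D) else 0)"

definition lipschitz :: "(real ^ 'n \<Rightarrow> real) \<Rightarrow> bool" where
  "lipschitz f \<longleftrightarrow> (\<exists>L. L-lipschitz_on UNIV f)"

text \<open>For a weight \<open>w\<close>, an exponent \<open>p > 0\<close> and Lipschitz \<open>f\<close>, all integrands are bounded
  measurable functions times \<open>w\<close>, hence integrable over \<open>Q\<close>; the constant may depend on \<open>w\<close> and \<open>p\<close>.\<close>

definition Poincare_inequality :: "real \<Rightarrow> (real ^ 'n \<Rightarrow> real) \<Rightarrow> bool" where
  "Poincare_inequality p w \<longleftrightarrow>
     (\<exists>c::real. \<forall>Q\<in>cubes. \<forall>f. lipschitz f \<longrightarrow>
        (INF a::real. (LINT x:Q|lebesgue. \<bar>f x - a\<bar> powr p * w x) powr (1 / p))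
        \<le> c * side_length Q * (LINT x:Q|lebesgue. norm (gradient f x) powr p * w x) powr (1 / p))"

end

theory Submission
  imports Defs
begin

text \<open>Let \<open>f\<close> rise linearly from \<open>- 1\<close> to \<open>1\<close> across the layer \<open>\<bar>x\<^sub>k\<bar> \<le> e\<close> of the cube \<open>[- 1, 1]\<^sup>n\<close> and
  be constant elsewhere. If a weight is at most \<open>e\<^sup>\<alpha>\<close> on this layer, then the energy of \<open>f\<close> with
  exponent \<open>r\<close> is of order \<open>e\<^sup>\<alpha>\<^sup>+\<^sup>1\<^sup>-\<^sup>r\<close>, which tends to \<open>0\<close> when \<open>r < \<alpha> + 1\<close>, while \<open>f\<close> stays away from
  any constant on one of the two sides of the layer. The weight \<open>1\<close> (\<open>\<alpha> = 0\<close>, \<open>r = q < 1\<close>) and the weight \<open>\<bar>x\<^sub>k\<bar>\<^sup>p\<close>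
  (\<open>\<alpha> = r = p\<close>), which lies in both \<open>RH\<^sub>\<infinity>\<close> and \<open>A\<^sub>\<infinity>\<close>, therefore violate the inequalities; the
  implication between them holds because its premise is false.\<close>

subsection \<open>Slabs of cubes\<close>

definition slab :: "real ^ 'n \<Rightarrow> real \<Rightarrow> 'n \<Rightarrow> real \<Rightarrow> real \<Rightarrow> (real ^ 'n) set" where
  "slab a l k u v = {x \<in> cbox a (\<chi> i. a $ i + l). x $ k \<in> {u..v}}"

text \<open>The bounds on \<open>u\<close> and \<open>v\<close> place the layer inside the cube, so
  cutting only replaces the k-th side. Measure and measurability then come from those of
  boxes.\<close>

lemma slab_eq_cbox:
  assumes "a $ k \<le> u" "v \<le> a $ k + l"
  shows "slab a l k u v = cbox (\<chi> i. if i = k then u else a $ i) (\<chi> i. if i = k then v else a $ i + l)"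
proof (rule set_eqI)
  fix x
  have "x \<in> slab a l k u v \<longleftrightarrow> (\<forall>i. a $ i \<le> x $ i \<and> x $ i \<le> a $ i + l) \<and> u \<le> x $ k \<and> x $ k \<le> v"
    by (auto simp: slab_def mem_box_cart)
  also have "\<dots> \<longleftrightarrow> (\<forall>i. (if i = k then u else a $ i) \<le> x $ i \<and> x $ i \<le> (if i = k then v else a $ i + l))"
    using assms by (smt (verit))
  finally show "x \<in> slab a l k u v \<longleftrightarrow>
      x \<in> cbox (\<chi> i. if i = k then u else a $ i) (\<chi> i. if i = k then v else a $ i + l)"
    by (simp add: mem_box_cart)
qed

lemma measure_slab:
  fixes a :: "real ^ 'n"
  assumes "a $ k \<le> u" "u \<le> v" "v \<le> a $ k + l" "0 \<le> l"
  shows "measure lebesgue (slab a l k u v) = (v - u) * l ^ (CARD('n) - 1)"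
proof -
  have "(\<Prod>i\<in>UNIV. (if i = k then v else a $ i + l) - (if i = k then u else a $ i))
      = (\<Prod>i\<in>UNIV. if i = k then v - u else l)"
    by (rule prod.cong) auto
  also have "\<dots> = (v - u) * l ^ (CARD('n) - 1)"
    by (simp add: prod.If_cases Compl_eq_Diff_UNIV card_Diff_singleton)
  finally show ?thesis
    using assms by (auto simp: slab_eq_cbox content_cbox_if_cart interval_eq_empty_cart not_less split: if_splits)
qed

lemma lmeasurable_slab:
  assumes "a $ k \<le> u" "v \<le> a $ k + l"
  shows "slab a l k u v \<in> lmeasurable"
  using assms by (simp add: slab_eq_cbox)

lemma measure_cube:
  fixes a :: "real ^ 'n"
  assumes "0 \<le> l"
  shows "measure lebesgue (cbox a (\<chi> i. a $ i + l)) = l ^ CARD('n)"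
  using assms by (auto simp: content_cbox_if_cart interval_eq_empty_cart not_less)

lemma emeasure_cube:
  fixes a :: "real ^ 'n"
  assumes "0 \<le> l"
  shows "emeasure lebesgue (cbox a (\<chi> i. a $ i + l)) = ennreal (l ^ CARD('n))"
  using emeasure_eq_ennreal_measure[OF fmeasurableD2[OF lmeasurable_cbox, of a "\<chi> i. a $ i + l"]]
  unfolding measure_cube[OF assms] .

subsection \<open>Bounds for set integrals\<close>

text \<open>Compare \<open>g\<close> on \<open>Q\<close> with the step function \<open>m\<close> on
  \<open>S\<close>. Integrability is assumed because a non-integrable function has Bochner integral
  0, which would defeat a positive lower bound.\<close>

lemma set_integral_ge_measure:
  fixes g :: "'a::euclidean_space \<Rightarrow> real"
  assumes "set_integrable lebesgue Q g" "S \<in> lmeasurable" "S \<subseteq> Q"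
    and "\<And>x. x \<in> Q \<Longrightarrow> 0 \<le> g x" "\<And>x. x \<in> S \<Longrightarrow> m \<le> g x"
  shows "m * measure lebesgue S \<le> (LINT x:Q|lebesgue. g x)"
proof -
  have "m * measure lebesgue S = (LINT x|lebesgue. m * indicator S x)"
    using assms(2) by simp
  also have "\<dots> \<le> (LINT x:Q|lebesgue. g x)"
    unfolding set_lebesgue_integral_def
  proof (rule integral_mono)
    show "integrable lebesgue (\<lambda>x. m * indicator S x)"
      using assms(2) by (intro integrable_mult_right integrable_real_indicator) (auto simp: fmeasurable_def)
    show "integrable lebesgue (\<lambda>x. indicat_real Q x *\<^sub>R g x)"
      using assms(1) by (simp add: set_integrable_def)
    show "m * indicator S x \<le> indicat_real Q x *\<^sub>R g x" for x
      using assms(3-5) by (auto simp: indicator_def)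
  qed
  finally show ?thesis .
qed

text \<open>The integrand may fail to be measurable, in which case the integral is \<open>0\<close>.\<close>

lemma set_integral_le_measure:
  fixes g :: "'a::euclidean_space \<Rightarrow> real"
  assumes "S \<in> lmeasurable" "0 \<le> B" "\<And>x. x \<in> Q \<Longrightarrow> g x \<le> B * indicator S x"
  shows "(LINT x:Q|lebesgue. g x) \<le> B * measure lebesgue S"
proof -
  have "(LINT x:Q|lebesgue. g x) \<le> (LINT x|lebesgue. B * indicator S x)"
    unfolding set_lebesgue_integral_def
  proof (rule integral_mono')
    show "integrable lebesgue (\<lambda>x. B * indicator S x)"
      using assms(1) by (intro integrable_mult_right integrable_real_indicator) (auto simp: fmeasurable_def)
    show "indicat_real Q x *\<^sub>R g x \<le> B * indicator S x" for x
      using assms(3)[of x] assms(2) by (auto simp: indicator_def)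
  qed (use assms(2) in auto)
  then show ?thesis
    using assms(1) by simp
qed

lemma set_integrable_compact_continuous:
  fixes g :: "'a::euclidean_space \<Rightarrow> real"
  assumes "compact K" "continuous_on UNIV g"
  shows "set_integrable lebesgue K g"
proof -
  have "integrable lborel (\<lambda>x. indicator K x *\<^sub>R g x)"
    by (intro borel_integrable_compact assms continuous_on_subset[OF assms(2)]) auto
  then show ?thesis
    unfolding set_integrable_def by (subst integrable_completion) auto
qed

subsection \<open>Gradients of Lipschitz functions\<close>

lemma gderiv_unique:
  assumes "GDERIV f x :> D" "GDERIV f x :> E"
  shows "D = E"
proof -
  have "(\<lambda>h. inner h D) = (\<lambda>h. inner h E)"
    using assms has_derivative_unique unfolding gderiv_def by blast
  then show ?thesis
    by (metis (mono_tags) vector_eq_ldot)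
qed

lemma gradient_eqI:
  assumes "GDERIV f x :> D"
  shows "gradient f x = D"
proof -
  have "f differentiable (at x)"
    using assms unfolding gderiv_def differentiable_def by blast
  moreover have "(THE D. GDERIV f x :> D) = D"
    using assms gderiv_unique by blast
  ultimately show ?thesis
    by (simp add: gradient_def)
qed

text \<open>Riesz representation: the derivative is a linear functional, represented by the vector
  \<open>adjoint f' 1\<close>.\<close>

lemma GDERIV_gradient:
  fixes f :: "real ^ 'n \<Rightarrow> real"
  assumes "f differentiable (at x)"
  shows "GDERIV f x :> gradient f x"
proof -
  obtain f' where f': "(f has_derivative f') (at x)"
    using assms unfolding differentiable_def by blast
  then have "linear f'"
    using has_derivative_linear by blast
  then have "f' = (\<lambda>h. inner h (adjoint f' 1))"
    using adjoint_works[of f' _ 1] by (auto simp: fun_eq_iff)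
  then have "GDERIV f x :> adjoint f' 1"
    using f' unfolding gderiv_def by simp
  then show ?thesis
    using gradient_eqI by metis
qed

text \<open>Differentiate along the gradient \<open>D\<close> itself: the directional derivative is
  the square of \<open>norm D\<close>, while the difference quotients are at most
  \<open>L * norm D\<close>. Where \<open>f\<close> is not differentiable, the default value 0
  satisfies the bound.\<close>

lemma norm_gradient_le_lipschitz:
  fixes f :: "real ^ 'n \<Rightarrow> real"
  assumes "L-lipschitz_on UNIV f"
  shows "norm (gradient f x) \<le> L"
proof (cases "f differentiable (at x)")
  case False
  then show ?thesis
    using lipschitz_on_nonneg[OF assms] by (simp add: gradient_def)
next
  case True
  define D where "D = gradient f x"
  have "(f has_derivative (\<lambda>h. inner h D)) (at x)"
    using GDERIV_gradient[OF True] by (simp add: gderiv_def D_def)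
  moreover have "((\<lambda>t. x + t *\<^sub>R D) has_derivative (\<lambda>t. t *\<^sub>R D)) (at (0::real))"
    by (auto intro!: derivative_eq_intros)
  ultimately have "((\<lambda>t. f (x + t *\<^sub>R D)) has_derivative (\<lambda>t. inner (t *\<^sub>R D) D)) (at 0)"
    using has_derivative_compose[of "\<lambda>t. x + t *\<^sub>R D" "\<lambda>t. t *\<^sub>R D" 0 UNIV f "\<lambda>h. inner h D"] by simp
  then have "DERIV (\<lambda>t. f (x + t *\<^sub>R D)) 0 :> inner D D"
    by (simp add: has_field_derivative_def mult_commute_abs)
  then have lim: "((\<lambda>t. (f (x + t *\<^sub>R D) - f x) / t) \<longlongrightarrow> inner D D) (at 0)"
    by (simp add: DERIV_def)
  have "inner D D \<le> L * norm D"
  proof (rule tendsto_upperbound[OF lim])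
    show "\<forall>\<^sub>F t in at 0. (f (x + t *\<^sub>R D) - f x) / t \<le> L * norm D"
    proof (rule eventuallyI)
      fix t :: real
      have "\<bar>f (x + t *\<^sub>R D) - f x\<bar> \<le> L * (\<bar>t\<bar> * norm D)"
        using lipschitz_onD[OF assms, of "x + t *\<^sub>R D" x] by (simp add: dist_norm)
      then have "\<bar>(f (x + t *\<^sub>R D) - f x) / t\<bar> \<le> L * norm D"
        using lipschitz_on_nonneg[OF assms]
        by (cases "t = 0") (auto simp: abs_divide divide_le_eq mult_ac)
      then show "(f (x + t *\<^sub>R D) - f x) / t \<le> L * norm D"
        by linarith
    qed
  qed simp
  then have "norm D * norm D \<le> L * norm D"
    by (simp add: power2_norm_eq_inner[symmetric] power2_eq_square)
  then show ?thesis
    using lipschitz_on_nonneg[OF assms] unfolding D_def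
    by (metis mult_le_cancel_right norm_ge_zero not_le order_antisym_conv)
qed

lemma gradient_locally_constant:
  assumes "open U" "x \<in> U" "\<And>y. y \<in> U \<Longrightarrow> f y = c"
  shows "gradient f x = 0"
proof (rule gradient_eqI)
  have "((\<lambda>_. c) has_derivative (\<lambda>_. 0)) (at x)"
    by simp
  then have "(f has_derivative (\<lambda>_. 0)) (at x)"
    by (rule has_derivative_transform_within_open[OF _ assms(1,2)]) (simp add: assms(3))
  then show "GDERIV f x :> 0"
    by (simp add: gderiv_def)
qed

subsection \<open>Failure of Poincare inequalities\<close>

definition ramp :: "'n \<Rightarrow> real \<Rightarrow> real ^ 'n \<Rightarrow> real" where
  "ramp k e x = max (- 1) (min 1 (x $ k / e))"

lemma ramp_lipschitz:
  fixes k :: "'n::finite"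
  assumes "0 < e"
  shows "(1 / e)-lipschitz_on UNIV (ramp k e)"
proof (rule lipschitz_onI)
  fix x y :: "real ^ 'n"
  have "\<bar>ramp k e x - ramp k e y\<bar> \<le> \<bar>x $ k / e - y $ k / e\<bar>"
    unfolding ramp_def by linarith
  also have "\<dots> = 1 / e * \<bar>(x - y) $ k\<bar>"
    using assms by (simp add: diff_divide_distrib[symmetric] abs_divide)
  also have "\<dots> \<le> 1 / e * norm (x - y)"
    using assms component_le_norm_cart[of "x - y" k] by (intro mult_left_mono) auto
  finally show "dist (ramp k e x) (ramp k e y) \<le> 1 / e * dist x y"
    by (simp add: dist_norm)
qed (use assms in auto)

text \<open>The strict inequality puts \<open>x\<close> into an open half-space on which the ramp is
  constant. The faces where the k-th coordinate is \<open>e\<close> or \<open>- e\<close> are left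
  to the Lipschitz bound.\<close>

lemma gradient_ramp_eq_0:
  assumes "0 < e" "e < \<bar>x $ k\<bar>"
  shows "gradient (ramp k e) x = 0"
proof (cases "x $ k > 0")
  case True
  show ?thesis
  proof (rule gradient_locally_constant)
    show "open {y. y $ k > e}"
      by (intro open_Collect_less continuous_intros)
    show "ramp k e y = 1" if "y \<in> {y. y $ k > e}" for y
      using that assms by (simp add: ramp_def min_def max_def field_simps)
  qed (use True assms in auto)
next
  case False
  show ?thesis
  proof (rule gradient_locally_constant)
    show "open {y. y $ k < - e}"
      by (intro open_Collect_less continuous_intros)
    show "ramp k e y = - 1" if "y \<in> {y. y $ k < - e}" for y
      using that assms by (simp add: ramp_def min_def max_def field_simps)
  qed (use False assms in auto)
qed

text \<open>The gradient lives on a layer of thickness \<open>2 * e\<close>, where its norm is at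
  most \<open>1 / e\<close> and the weight at most \<open>e powr \<alpha>\<close>; multiply these
  bounds by the measure of the layer.\<close>

lemma ramp_energy_le:
  fixes w :: "real ^ 'n \<Rightarrow> real"
  defines "Q \<equiv> cbox (\<chi> i. - 1) (\<chi> i. (\<chi> i. - 1) $ i + 2)"
  assumes "0 < r" "0 < e" "e \<le> 1"
    and "\<And>x. 0 \<le> w x" "\<And>x. \<bar>x $ k\<bar> \<le> e \<Longrightarrow> w x \<le> e powr \<alpha>"
  shows "(LINT x:Q|lebesgue. norm (gradient (ramp k e) x) powr r * w x)
    \<le> 2 ^ CARD('n) * e powr (\<alpha> + 1 - r)"
proof -
  let ?S = "slab (\<chi> i. - 1) 2 k (- e) e"
  have "(LINT x:Q|lebesgue. norm (gradient (ramp k e) x) powr r * w x)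
    \<le> ((1 / e) powr r * e powr \<alpha>) * measure lebesgue ?S"
  proof (rule set_integral_le_measure)
    fix x assume x: "x \<in> Q"
    show "norm (gradient (ramp k e) x) powr r * w x \<le> (1 / e) powr r * e powr \<alpha> * indicator ?S x"
    proof (cases "\<bar>x $ k\<bar> \<le> e")
      case True
      then have "x \<in> ?S"
        using x by (auto simp: slab_def Q_def)
      moreover have "norm (gradient (ramp k e) x) powr r * w x \<le> (1 / e) powr r * e powr \<alpha>"
        using assms True norm_gradient_le_lipschitz[OF ramp_lipschitz]
        by (intro mult_mono powr_mono2) auto
      ultimately show ?thesis
        by simp
    next
      case False
      then show ?thesis
        using gradient_ramp_eq_0[of e x k] assms by simp
    qed
  qed (use assms in \<open>auto intro!: lmeasurable_slab\<close>)
  also have "measure lebesgue ?S = (2 * e) * 2 ^ (CARD('n) - 1)"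
    using assms by (subst measure_slab) auto
  also have "\<dots> = 2 ^ CARD('n) * e"
    using power_minus_mult[of "CARD('n)" "2 :: real"] by (simp add: mult_ac)
  also have "(1 / e) powr r * e powr \<alpha> * (2 ^ CARD('n) * e) = 2 ^ CARD('n) * e powr (\<alpha> + 1 - r)"
    using assms by (simp add: powr_diff powr_add powr_divide field_simps)
  finally show ?thesis .
qed

text \<open>As \<open>e \<le> 1 / 2\<close>, the ramp equals -1 and 1 on the two outer quarters of
  the cube. Whatever \<open>a\<close> is, one of these values has distance at least 1 from it, and
  the weight is at least \<open>m\<close> on both quarters.\<close>

lemma ramp_oscillation_ge:
  fixes w :: "real ^ 'n \<Rightarrow> real"
  defines "Q \<equiv> cbox (\<chi> i. - 1) (\<chi> i. (\<chi> i. - 1) $ i + 2)"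
  assumes "0 < r" "0 < e" "e \<le> 1 / 2" "0 \<le> m"
    and cont: "continuous_on UNIV w"
    and "\<And>x. 0 \<le> w x" "\<And>x. 1 / 2 \<le> \<bar>x $ k\<bar> \<Longrightarrow> m \<le> w x"
  shows "m / 2 * 2 ^ (CARD('n) - 1) \<le> (LINT x:Q|lebesgue. \<bar>ramp k e x - a\<bar> powr r * w x)"
proof -
  have int: "set_integrable lebesgue Q (\<lambda>x. \<bar>ramp k e x - a\<bar> powr r * w x)"
    unfolding Q_def
    using lipschitz_on_continuous_on[OF ramp_lipschitz[OF \<open>0 < e\<close>]] assms
    by (intro set_integrable_compact_continuous compact_cbox continuous_on_mult cont
          continuous_on_powr' continuous_intros) auto
  \<comment> \<open>The two values of \<open>u\<close> are the lower ends of the outer quarters; the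
    sign of \<open>a\<close> decides below which of them is used.\<close>
  have far: "m * measure lebesgue (slab (\<chi> i. - 1) 2 k u (u + 1 / 2))
      \<le> (LINT x:Q|lebesgue. \<bar>ramp k e x - a\<bar> powr r * w x)"
    if u: "u \<in> {- 1, 1 / 2}" and "\<And>x. x $ k \<in> {u..u + 1 / 2} \<Longrightarrow> 1 \<le> \<bar>ramp k e x - a\<bar>" for u
  proof (rule set_integral_ge_measure[OF int])
    show "slab (\<chi> i. - 1) 2 k u (u + 1 / 2) \<in> lmeasurable"
      using u by (intro lmeasurable_slab) auto
    show "m \<le> \<bar>ramp k e x - a\<bar> powr r * w x"
      if "x \<in> slab (\<chi> i. - 1) 2 k u (u + 1 / 2)" for x
    proof -
      have "1 \<le> \<bar>ramp k e x - a\<bar> powr r"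
        using that u assms \<open>\<And>x. x $ k \<in> {u..u + 1 / 2} \<Longrightarrow> 1 \<le> \<bar>ramp k e x - a\<bar>\<close>
        by (intro ge_one_powr_ge_zero) (auto simp: slab_def)
      moreover have "1 / 2 \<le> \<bar>x $ k\<bar>"
        using that u by (auto simp: slab_def)
      ultimately show ?thesis
        using mult_mono[of 1 "\<bar>ramp k e x - a\<bar> powr r" m "w x"] assms by auto
    qed
  qed (use assms in \<open>auto simp: slab_def\<close>)
  show ?thesis
  proof (cases "0 \<le> a")
    case True
    have "1 \<le> \<bar>ramp k e x - a\<bar>" if "x $ k \<in> {- 1..- 1 + 1 / 2}" for x
    proof -
      have "x $ k / e \<le> - 1"
        using that assms by (auto simp: field_simps)
      then show ?thesis
        using True by (simp add: ramp_def)
    qed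
    then show ?thesis
      using far[of "- 1"] by (simp add: measure_slab)
  next
    case False
    have "1 \<le> \<bar>ramp k e x - a\<bar>" if "x $ k \<in> {1 / 2..1 / 2 + 1 / 2}" for x
    proof -
      have "1 \<le> x $ k / e"
        using that assms by (auto simp: field_simps)
      then show ?thesis
        using False by (simp add: ramp_def)
    qed
    then show ?thesis
      using far[of "1 / 2"] by (simp add: measure_slab)
  qed
qed

text \<open>On a fixed cube the left side for the ramp stays above a positive constant, while the
  right side is a positive power of \<open>e\<close>. Letting \<open>e\<close> tend to 0 gives the
  contradiction.\<close>

lemma not_Poincare_inequality:
  fixes w :: "real ^ 'n \<Rightarrow> real"
  assumes "0 < r" "r < \<alpha> + 1" "0 < m"
    and "continuous_on UNIV w" "\<And>x. 0 \<le> w x"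
    and upper: "\<And>x e. 0 < e \<Longrightarrow> \<bar>x $ k\<bar> \<le> e \<Longrightarrow> w x \<le> e powr \<alpha>"
    and lower: "\<And>x. 1 / 2 \<le> \<bar>x $ k\<bar> \<Longrightarrow> m \<le> w x"
  shows "\<not> Poincare_inequality r w"
proof
  assume "Poincare_inequality r w"
  \<comment> \<open>The upper corner is spelled as lower corner plus side length to match the shape
    of boxes in \<open>cubes\<close>.\<close>
  define Q :: "(real ^ 'n) set" where "Q = cbox (\<chi> i. - 1) (\<chi> i. (\<chi> i. - 1) $ i + 2)"
  have "Q \<in> cubes"
    unfolding cubes_def Q_def by fastforce
  with \<open>Poincare_inequality r w\<close> obtain c where c: "\<And>f. lipschitz f \<Longrightarrow>
        (INF a::real. (LINT x:Q|lebesgue. \<bar>f x - a\<bar> powr r * w x) powr (1 / r))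
        \<le> c * side_length Q * (LINT x:Q|lebesgue. norm (gradient f x) powr r * w x) powr (1 / r)"
    unfolding Poincare_inequality_def by blast
  define A where "A = m / 2 * 2 ^ (CARD('n) - 1)"
  \<comment> \<open>The constant \<open>c\<close> may be negative; the absolute value makes the
    right side monotone in the energy.\<close>
  define C where "C = \<bar>c * side_length Q\<bar>"
  have "0 < A"
    using assms by (simp add: A_def)
  have bound: "A powr (1 / r) \<le> C * (2 ^ CARD('n) * e powr (\<alpha> + 1 - r)) powr (1 / r)"
    if e: "0 < e" "e \<le> 1 / 2" for e
  proof -
    have "A powr (1 / r) \<le> (INF a::real. (LINT x:Q|lebesgue. \<bar>ramp k e x - a\<bar> powr r * w x) powr (1 / r))"
      using assms e \<open>0 < A\<close> unfolding A_def Q_def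
      by (intro cINF_greatest powr_mono2 ramp_oscillation_ge) auto
    also have "\<dots> \<le> c * side_length Q * (LINT x:Q|lebesgue. norm (gradient (ramp k e) x) powr r * w x) powr (1 / r)"
      using ramp_lipschitz[OF e(1)] by (intro c) (auto simp: lipschitz_def)
    also have "\<dots> \<le> C * (LINT x:Q|lebesgue. norm (gradient (ramp k e) x) powr r * w x) powr (1 / r)"
      unfolding C_def by (intro mult_right_mono) auto
    also have "\<dots> \<le> C * (2 ^ CARD('n) * e powr (\<alpha> + 1 - r)) powr (1 / r)"
    proof (intro mult_left_mono powr_mono2)
      show "0 \<le> (LINT x:Q|lebesgue. norm (gradient (ramp k e) x) powr r * w x)"
        unfolding set_lebesgue_integral_def using assms(5) by (intro Bochner_Integration.integral_nonneg) auto
      show "(LINT x:Q|lebesgue. norm (gradient (ramp k e) x) powr r * w x)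
        \<le> 2 ^ CARD('n) * e powr (\<alpha> + 1 - r)"
        unfolding Q_def using assms e by (intro ramp_energy_le) auto
    qed (use assms in \<open>auto simp: C_def\<close>)
    finally show ?thesis .
  qed
  \<comment> \<open>Since \<open>r < \<alpha> + 1\<close>, both exponents are positive, so
    \<open>powr\<close> is continuous from the right at base 0 and the limit is 0.\<close>
  have "((\<lambda>e. C * (2 ^ CARD('n) * e powr (\<alpha> + 1 - r)) powr (1 / r)) \<longlongrightarrow>
      C * (2 ^ CARD('n) * 0 powr (\<alpha> + 1 - r)) powr (1 / r)) (at_right 0)"
    using assms
    by (intro tendsto_intros tendsto_powr' ) (auto simp: eventually_at_filter)
  then have "A powr (1 / r) \<le> C * (2 ^ CARD('n) * 0 powr (\<alpha> + 1 - r)) powr (1 / r)"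
  proof (rule tendsto_lowerbound)
    show "\<forall>\<^sub>F e in at_right 0. A powr (1 / r) \<le> C * (2 ^ CARD('n) * e powr (\<alpha> + 1 - r)) powr (1 / r)"
      unfolding eventually_at_right_field using bound by (intro exI[of _ "1 / 2"]) auto
  qed simp
  then show False
    using \<open>0 < A\<close> by simp
qed

subsection \<open>Powers of a coordinate as weights\<close>

definition coord_weight :: "'n \<Rightarrow> real \<Rightarrow> real ^ 'n \<Rightarrow> real" where
  "coord_weight k p x = \<bar>x $ k\<bar> powr p"

lemma coord_weight_nonneg: "0 \<le> coord_weight k p x"
  by (simp add: coord_weight_def)

lemma continuous_on_coord_weight:
  assumes "0 < p"
  shows "continuous_on UNIV (coord_weight k p)"
  unfolding coord_weight_def using assms by (intro continuous_on_powr' continuous_intros) auto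

lemma weight_coord_weight:
  assumes "0 < p"
  shows "weight (coord_weight k p)"
  using assms by (simp add: weight_def coord_weight_nonneg set_integrable_compact_continuous
      continuous_on_coord_weight)

section \<open>Coordinate powers belong to \<open>RH_infinity\<close>\<close>

text \<open>Take the quarter at the endpoint farther from 0. The extreme case is an interval
  symmetric about 0, where that quarter is exactly the outer half of one side.\<close>

lemma interval_upper_quarter:
  fixes s l :: real
  assumes "0 < l"
  obtains u where "s \<le> u" "u + l / 4 \<le> s + l"
    "\<And>t. t \<in> {u..u + l / 4} \<Longrightarrow> max \<bar>s\<bar> \<bar>s + l\<bar> / 2 \<le> \<bar>t\<bar>"
proof (cases "\<bar>s\<bar> \<le> \<bar>s + l\<bar>")
  case True
  show ?thesis
    by (rule that[of "s + 3 / 4 * l"]) (use True assms in auto)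
next
  case False
  show ?thesis
    by (rule that[of s]) (use False assms in auto)
qed

lemma coord_weight_le:
  fixes a :: "real ^ 'n"
  assumes "0 < p" "x \<in> cbox a (\<chi> i. a $ i + l)"
  shows "coord_weight k p x \<le> max \<bar>a $ k\<bar> \<bar>a $ k + l\<bar> powr p"
proof -
  have "a $ k \<le> x $ k" "x $ k \<le> a $ k + l"
    using assms(2) by (auto simp: mem_box_cart)
  then show ?thesis
    unfolding coord_weight_def using assms(1) by (intro powr_mono2) auto
qed

text \<open>A quarter of the cube, cut off in direction \<open>k\<close> on the side far from 0,
  already contributes this much.\<close>

lemma average_coord_weight_ge:
  fixes a :: "real ^ 'n"
  assumes "0 < p" "0 < l"
  shows "(max \<bar>a $ k\<bar> \<bar>a $ k + l\<bar> / 2) powr p / 4 \<le> average (cbox a (\<chi> i. a $ i + l)) (coord_weight k p)"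
proof -
  define M where "M = max \<bar>a $ k\<bar> \<bar>a $ k + l\<bar>"
  let ?Q = "cbox a (\<chi> i. a $ i + l)"
  obtain u where u: "a $ k \<le> u" "u + l / 4 \<le> a $ k + l" "\<And>t. t \<in> {u..u + l / 4} \<Longrightarrow> M / 2 \<le> \<bar>t\<bar>"
    using interval_upper_quarter[OF assms(2), of "a $ k"] unfolding M_def by blast
  have "(M / 2) powr p * measure lebesgue (slab a l k u (u + l / 4))
    \<le> (LINT x:?Q|lebesgue. coord_weight k p x)"
  proof (rule set_integral_ge_measure)
    show "set_integrable lebesgue ?Q (coord_weight k p)"
      by (simp add: set_integrable_compact_continuous continuous_on_coord_weight assms(1))
    show "(M / 2) powr p \<le> coord_weight k p x" if "x \<in> slab a l k u (u + l / 4)" for x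
      unfolding coord_weight_def using that u(3)[of "x $ k"] assms(1)
      by (intro powr_mono2) (auto simp: slab_def M_def)
    show "slab a l k u (u + l / 4) \<in> lmeasurable"
      using u by (intro lmeasurable_slab) auto
  qed (auto simp: slab_def coord_weight_nonneg)
  also have "measure lebesgue (slab a l k u (u + l / 4)) = l ^ CARD('n) / 4"
    using u assms power_minus_mult[of "CARD('n)" l] by (subst measure_slab) (auto simp: mult.commute)
  finally have "1 / l ^ CARD('n) * ((M / 2) powr p * (l ^ CARD('n) / 4))
      \<le> 1 / l ^ CARD('n) * (LINT x:?Q|lebesgue. coord_weight k p x)"
    using assms by (intro mult_left_mono) auto
  then show ?thesis
    using assms unfolding average_def M_def measure_cube[OF less_imp_le[OF assms(2)]] by simp
qed

text \<open>With \<open>M\<close> the largest absolute value of the k-th coordinate on the cube, the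
  supremum is at most \<open>M powr p\<close> and the average at least
  \<open>(M / 2) powr p / 4\<close>; the quotient is the constant
  \<open>4 * 2 powr p\<close>.\<close>

lemma coord_weight_RH_infinity:
  fixes k :: "'n::finite"
  assumes "0 < p"
  shows "coord_weight k p \<in> (RH_infinity :: (real ^ 'n \<Rightarrow> real) set)"
  unfolding RH_infinity_def
proof (intro CollectI conjI exI ballI)
  show "weight (coord_weight k p)"
    by (rule weight_coord_weight[OF assms])
  fix Q :: "(real ^ 'n) set" assume "Q \<in> cubes"
  then obtain a l where Q: "Q = cbox a (\<chi> i. a $ i + l)" and l: "0 < l"
    unfolding cubes_def by blast
  define M where "M = max \<bar>a $ k\<bar> \<bar>a $ k + l\<bar>"
  have "0 \<le> M"
    by (simp add: M_def)
  \<comment> \<open>Measurability matters here: \<open>esssup\<close> of a non-measurable function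
    is the top element.\<close>
  have "coord_weight k p \<in> borel_measurable lebesgue"
    by (intro measurable_completion)
      (simp add: borel_measurable_continuous_onI continuous_on_coord_weight assms)
  then have meas: "(\<lambda>x. ennreal (coord_weight k p x)) \<in> borel_measurable (restrict_space lebesgue Q)"
    by (intro measurable_restrict_space1) measurable
  have "M powr p \<le> 4 * 2 powr p * average Q (coord_weight k p)"
    using average_coord_weight_ge[OF assms l, of a k] \<open>0 \<le> M\<close> unfolding Q M_def[symmetric]
    by (simp add: powr_divide field_simps)
  then have "ennreal (coord_weight k p x) \<le> ennreal (4 * 2 powr p * average Q (coord_weight k p))"
    if "x \<in> Q" for x
    using coord_weight_le[OF assms, of x a l k] that unfolding Q M_def[symmetric]
    by (intro ennreal_leI) auto
  then show "esssup (restrict_space lebesgue Q) (\<lambda>x. ennreal (coord_weight k p x))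
      \<le> ennreal (4 * 2 powr p * average Q (coord_weight k p))"
    by (intro esssup_I meas AE_I2) (auto simp: space_restrict_space)
qed

section \<open>Coordinate powers belong to a Muckenhoupt class\<close>

text \<open>Tonelli: the integrand times the indicator of the cube is a product of functions of
  single coordinates, and each of the other coordinates contributes a factor
  \<open>l\<close>.\<close>

lemma nn_integral_cube_coord:
  fixes a :: "real ^ 'n"
  assumes [measurable]: "g \<in> borel_measurable borel" and "0 \<le> l"
  shows "(\<integral>\<^sup>+x\<in>cbox a (\<chi> i. a $ i + l). g (x $ k) \<partial>lebesgue)
    = ennreal (l ^ (CARD('n) - 1)) * (\<integral>\<^sup>+t\<in>{a $ k..a $ k + l}. g t \<partial>lborel)"
proof -
  have basis: "(Basis :: (real ^ 'n) set) = range (\<lambda>i. axis i 1)"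
    by (auto simp: Basis_vec_def)
  have inj: "inj (\<lambda>i :: 'n. axis i (1 :: real))"
    by (auto simp: inj_on_def axis_eq_axis)
  define h where "h i t = (if i = k then g t else 1) * indicator {a $ i..a $ i + l} t" for i t
  have [measurable]: "h i \<in> borel_measurable borel" for i
    unfolding h_def by (cases "i = k") simp_all
  \<comment> \<open>The product formula for \<open>lborel\<close> is indexed by basis vectors, so
    the factors \<open>h i\<close> are transported along \<open>axis i 1\<close>.\<close>
  define f where "f b = h (THE i. b = axis i 1)" for b :: "real ^ 'n"
  have f_axis: "f (axis i 1) = h i" for i
    by (simp add: f_def axis_eq_axis)
  have "(\<integral>\<^sup>+x\<in>cbox a (\<chi> i. a $ i + l). g (x $ k) \<partial>lebesgue)
      = (\<integral>\<^sup>+x. g (x $ k) * indicator (cbox a (\<chi> i. a $ i + l)) x \<partial>lborel)"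
    by (rule nn_integral_completion)
  also have "\<dots> = (\<integral>\<^sup>+x. (\<Prod>b\<in>Basis. f b (x \<bullet> b)) \<partial>lborel)"
  proof (rule nn_integral_cong)
    fix x :: "real ^ 'n"
    have "(\<Prod>b\<in>Basis. f b (x \<bullet> b)) = (\<Prod>i\<in>UNIV. h i (x $ i))"
      by (simp add: basis prod.reindex[OF inj] f_axis inner_axis)
    also have "\<dots> = g (x $ k) * (\<Prod>i\<in>UNIV. indicator {a $ i..a $ i + l} (x $ i))"
      by (simp add: h_def prod.distrib)
    also have "(\<Prod>i\<in>UNIV. indicator {a $ i..a $ i + l} (x $ i))
        = (indicator (cbox a (\<chi> i. a $ i + l)) x :: ennreal)"
    proof (cases "x \<in> cbox a (\<chi> i. a $ i + l)")
      case True
      then show ?thesis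
        by (simp add: mem_box_cart)
    next
      case False
      then obtain i where "x $ i \<notin> {a $ i..a $ i + l}"
        by (auto simp: mem_box_cart)
      then show ?thesis
        using False by (subst prod_zero) (auto intro!: exI[of _ i])
    qed
    finally show "g (x $ k) * indicator (cbox a (\<chi> i. a $ i + l)) x = (\<Prod>b\<in>Basis. f b (x \<bullet> b))" ..
  qed
  also have "\<dots> = (\<Prod>b\<in>Basis. \<integral>\<^sup>+t. f b t \<partial>lborel)"
    by (rule nn_integral_lborel_prod) (auto simp: basis f_axis)
  also have "\<dots> = (\<Prod>i\<in>UNIV. \<integral>\<^sup>+t. h i t \<partial>lborel)"
    by (simp add: basis prod.reindex[OF inj] f_axis)
  also have "\<dots> = (\<integral>\<^sup>+t. h k t \<partial>lborel) * (\<Prod>i\<in>UNIV - {k}. \<integral>\<^sup>+t. h i t \<partial>lborel)"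
    by (rule prod.remove) auto
  also have "(\<Prod>i\<in>UNIV - {k}. \<integral>\<^sup>+t. h i t \<partial>lborel) = (\<Prod>i\<in>UNIV - {k}. ennreal l)"
    using assms(2) by (intro prod.cong) (auto simp: h_def)
  also have "\<dots> = ennreal (l ^ (CARD('n) - 1))"
    using assms(2) by (simp add: card_Diff_singleton ennreal_power)
  finally show ?thesis
    by (simp add: h_def mult.commute)
qed

text \<open>An interval short compared with its distance to \<open>0\<close> carries an almost constant integrand;
  a long one is contained in \<open>{- M..M}\<close>, where the integral is \<open>4 * M powr (1 / 2)\<close>.\<close>

lemma nn_integral_inverse_sqrt_le:
  fixes s l :: real
  assumes "0 < l"
  defines "M \<equiv> max \<bar>s\<bar> \<bar>s + l\<bar>"
  shows "(\<integral>\<^sup>+t\<in>{s..s + l}. inverse (ennreal (\<bar>t\<bar> powr (1 / 2))) \<partial>lborel)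
    \<le> ennreal (8 * l * M powr (- 1 / 2))"
proof -
  have "0 < M"
    using assms by (auto simp: M_def)
  show ?thesis
  proof (cases "l < M / 2")
    case True
    have "(\<integral>\<^sup>+t\<in>{s..s + l}. inverse (ennreal (\<bar>t\<bar> powr (1 / 2))) \<partial>lborel)
        \<le> (\<integral>\<^sup>+t\<in>{s..s + l}. ennreal (8 * M powr (- 1 / 2)) \<partial>lborel)"
    proof (rule nn_integral_mono)
      fix t :: real
      have "inverse (ennreal (\<bar>t\<bar> powr (1 / 2))) \<le> ennreal (8 * M powr (- 1 / 2))" if "t \<in> {s..s + l}"
      proof -
        \<comment> \<open>Every point is within \<open>l < M / 2\<close> of the endpoint of absolute
          value \<open>M\<close>. The weaker bound \<open>M / 4\<close> has a rational square root
          factor.\<close>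
        have t: "M / 4 \<le> \<bar>t\<bar>"
          using that True \<open>0 < M\<close> unfolding M_def by auto
        have "inverse (\<bar>t\<bar> powr (1 / 2)) = \<bar>t\<bar> powr (- 1 / 2)"
          by (simp add: powr_minus)
        also have "\<dots> \<le> (M / 4) powr (- 1 / 2)"
          using t \<open>0 < M\<close> by (intro powr_mono2') auto
        also have "\<dots> = 2 * M powr (- 1 / 2)"
          using \<open>0 < M\<close> by (simp add: powr_minus powr_divide powr_half_sqrt real_sqrt_divide divide_simps)
        also have "\<dots> \<le> 8 * M powr (- 1 / 2)"
          by simp
        finally show ?thesis
          using t \<open>0 < M\<close> by (simp add: inverse_ennreal ennreal_leI)
      qed
      then show "inverse (ennreal (\<bar>t\<bar> powr (1 / 2))) * indicator {s..s + l} t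
          \<le> ennreal (8 * M powr (- 1 / 2)) * indicator {s..s + l} t"
        by (auto simp: indicator_def)
    qed
    also have "\<dots> = ennreal (8 * M powr (- 1 / 2)) * ennreal l"
      using assms(1) by (subst nn_integral_cmult_indicator) simp_all
    also have "\<dots> = ennreal (8 * l * M powr (- 1 / 2))"
      using assms(1) by (subst ennreal_mult[symmetric]) (simp_all add: mult_ac)
    finally show ?thesis .
  next
    case False
    define F :: "real \<Rightarrow> ennreal"
      where "F t = inverse (ennreal (\<bar>t\<bar> powr (1 / 2))) * indicator {0..M} t" for t
    have [measurable]: "F \<in> borel_measurable borel"
      unfolding F_def by measurable
    have F: "(\<integral>\<^sup>+t. F t \<partial>lborel) = ennreal (2 * M powr (1 / 2))"
    proof -
      have "(\<integral>\<^sup>+t. F t \<partial>lborel) = (\<integral>\<^sup>+t. ennreal (indicator {0..M} t * t powr (- 1 / 2)) \<partial>lborel)"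
      proof (rule nn_integral_cong_AE)
        \<comment> \<open>At 0 the two integrands differ: the inverse in \<open>ennreal\<close> is
          infinite, whereas \<open>0 powr (- 1 / 2)\<close> is 0.\<close>
        have "AE t in lborel. t \<noteq> (0 :: real)"
          by (rule AE_lborel_singleton)
        then show "AE t in lborel. F t = ennreal (indicator {0..M} t * t powr (- 1 / 2))"
          by eventually_elim (auto simp: F_def indicator_def inverse_ennreal powr_minus)
      qed
      also have "\<dots> = ennreal (M powr (- 1 / 2 + 1) / (- 1 / 2 + 1))"
        using \<open>0 < M\<close>
        by (intro nn_integral_has_integral_lebesgue has_integral_powr_from_0) auto
      finally show ?thesis
        by (simp add: mult.commute)
    qed
    have "(\<integral>\<^sup>+t. F (- t) \<partial>lborel) = (\<integral>\<^sup>+t. F t \<partial>distr lborel borel uminus)"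
      by (simp add: nn_integral_distr)
    then have F': "(\<integral>\<^sup>+t. F (- t) \<partial>lborel) = ennreal (2 * M powr (1 / 2))"
      by (simp add: lborel_distr_uminus F)
    have "(\<integral>\<^sup>+t\<in>{s..s + l}. inverse (ennreal (\<bar>t\<bar> powr (1 / 2))) \<partial>lborel)
        \<le> (\<integral>\<^sup>+t. F t + F (- t) \<partial>lborel)"
      by (intro nn_integral_mono) (auto simp: F_def indicator_def M_def)
    also have "\<dots> = ennreal (4 * M powr (1 / 2))"
      by (simp add: nn_integral_add F F' ennreal_plus[symmetric] del: ennreal_plus)
    also have "\<dots> \<le> ennreal (8 * l * M powr (- 1 / 2))"
    proof (rule ennreal_leI)
      have "4 * M powr (1 / 2) = 4 * M * M powr (- 1 / 2)"
        using \<open>0 < M\<close> by (simp add: powr_minus powr_half_sqrt field_simps)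
      \<comment> \<open>Here \<open>M \<le> 2 * l\<close>, which turns \<open>4 * M\<close> into
        \<open>8 * l\<close>; this is the source of the constant 8.\<close>
      also have "\<dots> \<le> 8 * l * M powr (- 1 / 2)"
        using False by (intro mult_right_mono) auto
      finally show "4 * M powr (1 / 2) \<le> 8 * l * M powr (- 1 / 2)" .
    qed
    finally show ?thesis .
  qed
qed

lemma nn_average_coord_weight_le:
  fixes a :: "real ^ 'n"
  assumes "0 < p" "0 < l"
  shows "nn_average (cbox a (\<chi> i. a $ i + l)) (\<lambda>x. ennreal (coord_weight k p x))
    \<le> ennreal (max \<bar>a $ k\<bar> \<bar>a $ k + l\<bar> powr p)"
proof -
  let ?Q = "cbox a (\<chi> i. a $ i + l)"
  let ?B = "max \<bar>a $ k\<bar> \<bar>a $ k + l\<bar> powr p"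
  have Q: "emeasure lebesgue ?Q = ennreal (l ^ CARD('n))"
    using assms by (intro emeasure_cube) simp
  have "(\<integral>\<^sup>+x\<in>?Q. ennreal (coord_weight k p x) \<partial>lebesgue) \<le> (\<integral>\<^sup>+x\<in>?Q. ennreal ?B \<partial>lebesgue)"
    using coord_weight_le[OF assms(1), of _ a l k]
    by (intro nn_integral_mono) (auto simp: indicator_def intro!: ennreal_leI)
  also have "\<dots> = ennreal ?B * ennreal (l ^ CARD('n))"
    by (subst nn_integral_cmult_indicator) (auto simp: Q)
  finally show ?thesis
    using assms unfolding nn_average_def Q
    by (intro divide_le_posI_ennreal) (simp_all add: mult.commute[of "ennreal ?B"])
qed

lemma nn_average_inverse_sqrt_le:
  fixes a :: "real ^ 'n"
  assumes "0 < l"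
  shows "nn_average (cbox a (\<chi> i. a $ i + l)) (\<lambda>x. inverse (ennreal (\<bar>x $ k\<bar> powr (1 / 2))))
    \<le> ennreal (8 * max \<bar>a $ k\<bar> \<bar>a $ k + l\<bar> powr (- 1 / 2))"
proof -
  let ?Q = "cbox a (\<chi> i. a $ i + l)"
  let ?B = "max \<bar>a $ k\<bar> \<bar>a $ k + l\<bar> powr (- 1 / 2)"
  have Q: "emeasure lebesgue ?Q = ennreal (l ^ CARD('n))"
    using assms by (intro emeasure_cube) simp
  have "(\<integral>\<^sup>+x\<in>?Q. inverse (ennreal (\<bar>x $ k\<bar> powr (1 / 2))) \<partial>lebesgue)
      = ennreal (l ^ (CARD('n) - 1)) *
        (\<integral>\<^sup>+t\<in>{a $ k..a $ k + l}. inverse (ennreal (\<bar>t\<bar> powr (1 / 2))) \<partial>lborel)"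
    by (rule nn_integral_cube_coord[OF _ less_imp_le[OF assms]]) measurable
  also have "\<dots> \<le> ennreal (l ^ (CARD('n) - 1)) * ennreal (8 * l * ?B)"
    by (rule mult_left_mono[OF nn_integral_inverse_sqrt_le[OF assms] zero_le])
  also have "\<dots> = ennreal (l ^ CARD('n)) * ennreal (8 * ?B)"
  proof -
    have "l ^ (CARD('n) - 1) * (8 * l * ?B) = (l ^ (CARD('n) - 1) * l) * (8 * ?B)"
      by (simp only: mult_ac)
    also have "l ^ (CARD('n) - 1) * l = l ^ CARD('n)"
      by (rule power_minus_mult) simp
    finally show ?thesis
      using assms by (simp add: ennreal_mult[symmetric] del: One_nat_def)
  qed
  finally show ?thesis
    using assms unfolding nn_average_def Q
    by (intro divide_le_posI_ennreal) auto
qed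

lemma ennreal_powr_le:
  assumes "x \<le> ennreal y" "0 \<le> y" "0 < r"
  shows "ennreal_powr x r \<le> ennreal (y powr r)"
proof -
  have "x \<noteq> \<infinity>"
    using assms(1) by (auto simp: top_unique)
  moreover have "enn2real x \<le> y"
    using assms by (simp add: enn2real_leI)
  ultimately show ?thesis
    using assms by (auto simp: ennreal_powr_def intro!: ennreal_leI powr_mono2)
qed

text \<open>The index \<open>2 * p + 1\<close> turns the dual weight into the inverse square root of
  the absolute k-th coordinate, an integrable singularity. The two averages are bounded by
  \<open>M powr p\<close> and \<open>8 * M powr (- 1 / 2)\<close>; raising the latter to
  \<open>2 * p\<close> cancels \<open>M\<close>.\<close>

lemma coord_weight_Muckenhoupt:
  fixes k :: "'n::finite"
  assumes "0 < p"
  shows "coord_weight k p \<in> (Muckenhoupt (2 * p + 1) :: (real ^ 'n \<Rightarrow> real) set)"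
proof -
  have "nn_average Q (\<lambda>x. ennreal (coord_weight k p x)) *
      ennreal_powr (nn_average Q (\<lambda>x. inverse (ennreal (coord_weight k p x powr (1 / (2 * p)))))) (2 * p)
      \<le> ennreal (8 powr (2 * p))" if "Q \<in> cubes" for Q :: "(real ^ 'n) set"
  proof -
    obtain a l where Q: "Q = cbox a (\<chi> i. a $ i + l)" and l: "0 < l"
      using \<open>Q \<in> cubes\<close> unfolding cubes_def by blast
    define M where "M = max \<bar>a $ k\<bar> \<bar>a $ k + l\<bar>"
    \<comment> \<open>An interval of positive length cannot have both endpoints 0; the final
      cancellation of powers of \<open>M\<close> relies on this.\<close>
    have "0 < M"
      using l by (auto simp: M_def)
    have sqrt: "coord_weight k p x powr (1 / (2 * p)) = \<bar>x $ k\<bar> powr (1 / 2)" for x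
      using assms by (simp add: coord_weight_def powr_powr)
    have "nn_average Q (\<lambda>x. ennreal (coord_weight k p x)) *
        ennreal_powr (nn_average Q (\<lambda>x. inverse (ennreal (coord_weight k p x powr (1 / (2 * p)))))) (2 * p)
        \<le> ennreal (M powr p) * ennreal ((8 * M powr (- 1 / 2)) powr (2 * p))"
      unfolding Q M_def sqrt using assms l
      by (intro mult_mono nn_average_coord_weight_le ennreal_powr_le nn_average_inverse_sqrt_le) auto
    also have "\<dots> = ennreal (M powr p * (8 * M powr (- 1 / 2)) powr (2 * p))"
      by (simp add: ennreal_mult)
    also have "(8 * M powr (- 1 / 2)) powr (2 * p) = 8 powr (2 * p) * M powr (- p)"
      by (simp add: powr_mult powr_powr)
    also have "M powr p * (8 powr (2 * p) * M powr (- p)) = 8 powr (2 * p)"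
      using \<open>0 < M\<close> by (simp add: powr_minus)
    finally show ?thesis .
  qed
  then have bound: "\<exists>c::real. \<forall>Q\<in>cubes. nn_average Q (\<lambda>x :: real ^ 'n. ennreal (coord_weight k p x)) *
      ennreal_powr (nn_average Q (\<lambda>x. inverse (ennreal (coord_weight k p x powr (1 / (2 * p)))))) (2 * p)
      \<le> ennreal c"
    by blast
  have q: "2 * p + 1 \<noteq> 1" "2 * p + 1 - 1 = 2 * p"
    using assms by simp_all
  show ?thesis
    unfolding Muckenhoupt_def mem_Collect_eq if_not_P[OF q(1)] q(2)
    by (intro conjI weight_coord_weight assms bound)
qed

section \<open>The counterexamples and the conclusion\<close>

lemma coord_weight_not_Poincare:
  fixes k :: "'n::finite"
  assumes "0 < p"
  shows "\<not> Poincare_inequality p (coord_weight k p :: real ^ 'n \<Rightarrow> real)"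
proof (rule not_Poincare_inequality[where \<alpha> = p and m = "(1 / 2) powr p" and k = k])
  show "coord_weight k p x \<le> e powr p" if "\<bar>x $ k\<bar> \<le> e" for x :: "real ^ 'n" and e
    using that assms unfolding coord_weight_def by (intro powr_mono2) auto
  show "(1 / 2) powr p \<le> coord_weight k p x" if "1 / 2 \<le> \<bar>x $ k\<bar>" for x :: "real ^ 'n"
    using that assms unfolding coord_weight_def by (intro powr_mono2) auto
qed (use assms in \<open>auto simp: coord_weight_nonneg continuous_on_coord_weight\<close>)

theorem theorem1p26:
  fixes p :: real
  assumes "1 \<le> p"
  shows "((\<forall>w \<in> (RH_infinity :: (real ^ 'n \<Rightarrow> real) set). Poincare_inequality p w) \<longrightarrow>
            (\<forall>q. 0 < q \<and> q < 1 \<longrightarrow> Poincare_inequality q (\<lambda>x :: real ^ 'n. 1)))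
       \<and> (\<forall>q. 0 < q \<and> q < 1 \<longrightarrow> \<not> Poincare_inequality q (\<lambda>x :: real ^ 'n. 1))
       \<and> \<not> (\<forall>w \<in> (RH_infinity :: (real ^ 'n \<Rightarrow> real) set). Poincare_inequality p w)
       \<and> \<not> (\<forall>w \<in> (A_infinity :: (real ^ 'n \<Rightarrow> real) set). Poincare_inequality p w)"
proof -
  fix k :: 'n
  have "0 < p"
    using assms by simp
  have "coord_weight k p \<in> A_infinity"
    using coord_weight_Muckenhoupt[OF \<open>0 < p\<close>, of k] \<open>0 < p\<close>
    unfolding A_infinity_def by (intro UN_I[of "2 * p + 1"]) auto
  then have A: "\<not> (\<forall>w \<in> (A_infinity :: (real ^ 'n \<Rightarrow> real) set). Poincare_inequality p w)"
    using coord_weight_not_Poincare[OF \<open>0 < p\<close>] by blast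
  have RH: "\<not> (\<forall>w \<in> (RH_infinity :: (real ^ 'n \<Rightarrow> real) set). Poincare_inequality p w)"
    using coord_weight_RH_infinity[OF \<open>0 < p\<close>] coord_weight_not_Poincare[OF \<open>0 < p\<close>] by blast
  \<comment> \<open>For the constant weight, \<open>\<alpha> = 0\<close> reduces the condition
    \<open>r < \<alpha> + 1\<close> to \<open>q < 1\<close>.\<close>
  have "\<not> Poincare_inequality q (\<lambda>x :: real ^ 'n. 1)" if "0 < q" "q < 1" for q
    using that by (intro not_Poincare_inequality[where \<alpha> = 0 and m = 1]) auto
  with A RH show ?thesis
    by blast
qed

end
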